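(* Let $\lambda$ be a frequency, $\ell\ge 0$, and let $f:[\mathrm{Re}>0]\to\mathbb{C}$ be a holomorphic function which has a $\lambda$-Riesz germ. (1) If $f\in H_{\infty,\ell}^{\lambda}[\mathrm{Re}>0]$, then there is $C>0$ such that for all $\sigma>0$ and all $|t|>1$ $$|f(\sigma+it)|\le C|t|^{\ell}.$$ In particular, if $f\in H_{\infty,\ell}^{\lambda}[\mathrm{Re}>0]$, then $f$ has finite uniform order $\nu_f\le\ell$ on $[\mathrm{Re}>0]$. (2) Conversely, $f_\mu=f(\mu+\cdot)\in H_{\infty,\ell}^{\lambda}[\mathrm{Re}>0]$ for all $\mu>0$ whenever there are $C,t_0>0$ such that for all $\sigma>0$ and all $|t|>t_0$ $$|f(\sigma+it)|\le C|t|^{\ell};$$ so in particular this holds if $f$ has finite uniform order $\nu_f<\ell$ on $[\mathrm{Re}>0]$.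
   Context: A frequency is a strictly increasing sequence $\lambda=(\lambda_n)_{n\ge 1}$ of non-negative real numbers with $\lambda_n\to\infty$. A $\lambda$-Dirichlet series is a formal series $D=\sum a_n e^{-\lambda_n s}$ with complex coefficients $a_n$. Write $[\mathrm{Re}>\sigma]=\{s\in\mathbb{C}:\mathrm{Re}\,s>\sigma\}$. A $\lambda$-Dirichlet series $D=\sum a_ne^{-\lambda_ns}$ is a $\lambda$-Riesz germ of a holomorphic function $f:[\mathrm{Re}>0]\to\mathbb{C}$ if for some $m\ge 0$ and some $\sigma\ge 0$ one has $f(s)=\lim_{x\to\infty}\sum_{\lambda_n<x}a_ne^{-\lambda_ns}\big(1-\frac{\lambda_n}{x}\big)^m$ for all $s\in[\mathrm{Re}>\sigma]$. For $\ell\ge 0$, $H_{\infty,\ell}^{\lambda}[\mathrm{Re}>0]$ is the linear space of all holomorphic $f:[\mathrm{Re}>0]\to\mathbb{C}$ which have a $\lambda$-Riesz germ and satisfy $\|f\|_{\infty,\ell}=\sup_{\mathrm{Re}\,s>0}\frac{|f(s)|}{(1+|s|)^{\ell}}<\infty$. The uniform order $\nu_f\in[0,\infty]$ of a holomorphic $f$ on $[\mathrm{Re}>0]$ is the infimum of all $\ell\ge 0$ for which there exist $C,t_0>0$ such that $|f(\sigma+it)|\le C|t|^{\ell}$ for all $\sigma>0$ and all $|t|>t_0$; $f$ has finite uniform order if $\nu_f<\infty$. *)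

theory Defs
  imports "HOL-Complex_Analysis.Complex_Analysis" "HOL-Library.Extended_Real"
begin

definition half_plane :: "real \<Rightarrow> complex set"
  where "half_plane \<sigma> = {s. Re s > \<sigma>}"

text \<open>Sequences are indexed from 0, so \<open>lam 0\<close> is the mathematical \<open>\<lambda>\<^sub>1\<close>.\<close>

definition frequency :: "(nat \<Rightarrow> real) \<Rightarrow> bool"
  where "frequency lam \<longleftrightarrow>
    strict_mono lam \<and> (\<forall>n. 0 \<le> lam n) \<and> filterlim lam at_top sequentially"

text \<open>A \<open>lam\<close>-Dirichlet series is given by its coefficient sequence \<open>a\<close>. For a frequency
  \<open>lam\<close> the index set of the following sum is finite, and every base \<open>1 - lam n / x\<close> that
  occurs is positive, so \<open>powr\<close> is the usual power, also for \<open>m = 0\<close>.\<close>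

definition riesz_mean ::
    "(nat \<Rightarrow> real) \<Rightarrow> (nat \<Rightarrow> complex) \<Rightarrow> real \<Rightarrow> real \<Rightarrow> complex \<Rightarrow> complex"
  where "riesz_mean lam a m x s =
    (\<Sum>n | lam n < x. a n * exp (- of_real (lam n) * s) * of_real ((1 - lam n / x) powr m))"

definition riesz_germ :: "(nat \<Rightarrow> real) \<Rightarrow> (nat \<Rightarrow> complex) \<Rightarrow> (complex \<Rightarrow> complex) \<Rightarrow> bool"
  where "riesz_germ lam a f \<longleftrightarrow>
    (\<exists>m\<ge>0. \<exists>\<sigma>\<ge>0. \<forall>s\<in>half_plane \<sigma>. ((\<lambda>x. riesz_mean lam a m x s) \<longlongrightarrow> f s) at_top)"

definition has_riesz_germ :: "(nat \<Rightarrow> real) \<Rightarrow> (complex \<Rightarrow> complex) \<Rightarrow> bool"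
  where "has_riesz_germ lam f \<longleftrightarrow> (\<exists>a. riesz_germ lam a f)"

definition growth_norm :: "real \<Rightarrow> (complex \<Rightarrow> complex) \<Rightarrow> ereal"
  where "growth_norm l f = (SUP s\<in>half_plane 0. ereal (cmod (f s) / (1 + cmod s) powr l))"

text \<open>Functions on the half-plane are total functions whose values elsewhere are irrelevant.\<close>

definition H_infty :: "(nat \<Rightarrow> real) \<Rightarrow> real \<Rightarrow> (complex \<Rightarrow> complex) set"
  where "H_infty lam l =
    {f. f holomorphic_on half_plane 0 \<and> has_riesz_germ lam f \<and> growth_norm l f < \<infinity>}"

text \<open>In \<open>ereal\<close> the infimum of the empty set is \<open>\<infinity>\<close>.\<close>

definition uniform_order :: "(complex \<Rightarrow> complex) \<Rightarrow> ereal"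
  where "uniform_order f = Inf (ereal ` {l. 0 \<le> l \<and>
    (\<exists>C>0. \<exists>t0>0. \<forall>\<sigma>>0. \<forall>t. \<bar>t\<bar> > t0 \<longrightarrow> cmod (f (Complex \<sigma> t)) \<le> C * \<bar>t\<bar> powr l)})"

definition finite_uniform_order :: "(complex \<Rightarrow> complex) \<Rightarrow> bool"
  where "finite_uniform_order f \<longleftrightarrow> uniform_order f < \<infinity>"

end

theory Submission
  imports Defs
begin

text \<open>
  A function with a Riesz germ is bounded on the part of the sector \<open>\<bar>Im s\<bar> \<le> Re s\<close> far enough to the
  right. Where \<open>\<bar>Im s\<bar>\<close> is bounded away from zero on the rest of the half-plane, it is comparable
  to \<open>\<bar>s\<bar>\<close>, so that the two growth conditions agree there; what remains, after the shift by \<open>\<mu>\<close>, is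
  a compact rectangle.

  For the boundedness one may take the order of the Riesz means to be an integer \<open>k\<close>, as convergence
  passes to higher orders. If the means of order \<open>k\<close> are bounded at \<open>s\<close>, then Taylor's formula
  for \<open>t\<^sup>k exp (w t)\<close> writes the mean at \<open>s + w\<close> as an integral over the means at \<open>s\<close>, and this bounds
  it by a power of \<open>\<bar>w\<bar> / Re w\<close>, uniformly in the summation parameter.
\<close>

section \<open>Riesz means as finite sums\<close>

lemma finite_frequency_below:
  assumes "frequency lam"
  shows "finite {n. lam n < x}"
proof -
  have "eventually (\<lambda>n. x \<le> lam n) sequentially"
    using assms by (simp add: frequency_def filterlim_at_top)
  then obtain N where "\<And>n. n \<ge> N \<Longrightarrow> x \<le> lam n"
    by (auto simp: eventually_sequentially)
  then have "{n. lam n < x} \<subseteq> {..<N}"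
    by (auto simp: not_le[symmetric])
  then show ?thesis
    by (rule finite_subset) simp
qed

lemma riesz_mean_nonpos:
  assumes "frequency lam" "x \<le> 0"
  shows "riesz_mean lam a m x s = 0"
proof -
  have "{n. lam n < x} = {}"
    using assms by (auto simp: frequency_def not_less intro: order_trans)
  then show ?thesis
    unfolding riesz_mean_def by simp
qed

text \<open>Multiplying by \<open>x ^ k\<close> clears the denominators and turns real powers into
  the polynomials \<open>(x - lam n) ^ k\<close>, the shape to which Taylor's formula
  applies.\<close>

lemma riesz_mean_of_nat:
  assumes "frequency lam" "0 \<le> x"
  shows "riesz_mean lam a (real k) x s * of_real x ^ k =
    (\<Sum>n | lam n < x. a n * exp (- of_real (lam n) * s) * of_real ((x - lam n) ^ k))"
proof (cases "x = 0")
  case True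
  then have "{n. lam n < x} = {}"
    using assms by (auto simp: frequency_def not_less)
  then show ?thesis
    unfolding riesz_mean_def by simp
next
  case False
  have "complex_of_real ((1 - lam n / x) powr real k) * of_real x ^ k = of_real ((x - lam n) ^ k)"
    if "lam n < x" for n
  proof -
    have "(1 - lam n / x) powr real k * x ^ k = (x - lam n) ^ k"
      using that assms False
      by (simp add: powr_realpow left_diff_distrib flip: power_mult_distrib)
    then show ?thesis
      by (simp flip: of_real_mult of_real_power)
  qed
  then show ?thesis
    unfolding riesz_mean_def sum_distrib_right by (intro sum.cong) (auto simp: mult.assoc)
qed

section \<open>Taylor's formula for a power times an exponential, and a bound for its kernel\<close>

text \<open>Leibniz rule. The \<open>pochhammer\<close> factor is the falling factorial of
  \<open>k\<close> of length \<open>j\<close>; for \<open>j > k\<close> the truncated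
  \<open>Suc k - j\<close> is 0 and the factor vanishes.\<close>

lemma higher_deriv_power_mult_exp:
  fixes w z :: complex
  shows "(deriv ^^ i) (\<lambda>z. z ^ k * exp (w * z)) z =
    (\<Sum>j\<le>i. of_nat (i choose j) * (pochhammer (of_nat (Suc k - j)) j * z ^ (k - j))
       * (w ^ (i - j) * exp (w * z)))"
proof -
  have e: "(deriv ^^ n) exp z = exp z" for n and z :: complex
  proof (induction n arbitrary: z)
    case (Suc n)
    then have "(deriv ^^ n) exp = (exp :: complex \<Rightarrow> complex)" by auto
    then show ?case by (simp add: DERIV_imp_deriv)
  qed auto
  have "(deriv ^^ n) (\<lambda>z. exp (w * z)) z = w ^ n * exp (w * z)" for n
    using higher_deriv_compose_linear[of exp UNIV UNIV z w n]
    by (simp add: e holomorphic_on_exp)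
  moreover have "(deriv ^^ j) (\<lambda>z. z ^ k) z = pochhammer (of_nat (Suc k - j)) j * z ^ (k - j)" for j
    using higher_deriv_power[of j 0 k z] by simp
  ultimately show ?thesis
    by (subst higher_deriv_mult[where S = UNIV])
      (auto intro!: holomorphic_intros simp: atLeast0AtMost simp del: higher_deriv_linear)
qed

lemma pochhammer_eq_fact_div:
  assumes "j \<le> k"
  shows "pochhammer (of_nat (Suc k - j)) j = (fact k / fact (k - j) :: 'a :: field_char_0)"
proof -
  have "(fact k :: 'a) = pochhammer 1 (k - j + j)"
    using assms by (simp add: pochhammer_fact)
  also have "\<dots> = fact (k - j) * pochhammer (of_nat (Suc k - j)) j"
    using assms unfolding pochhammer_product' by (simp add: pochhammer_fact Suc_diff_le)
  finally show ?thesis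
    by (simp add: field_simps)
qed

text \<open>The Taylor polynomial of degree \<open>k\<close> at 0 of
  \<open>z ^ k * exp (w * z)\<close> is just \<open>z ^ k\<close>, so the integral remainder is the
  difference of the function and the power. It is used with \<open>T = x - lam n\<close>.\<close>

lemma power_mult_exp_Taylor:
  fixes w :: complex
  assumes "0 \<le> T"
  shows "((\<lambda>t. of_real ((T - t) ^ k / fact k) *
            (deriv ^^ Suc k) (\<lambda>z. z ^ k * exp (w * z)) (of_real t))
          has_integral of_real (T ^ k) * exp (w * of_real T) - of_real (T ^ k)) {0..T}"
proof -
  let ?h = "\<lambda>z. z ^ k * exp (w * z)"
  have "((\<lambda>t. ((T - t) ^ (Suc k - 1) / fact (Suc k - 1)) *\<^sub>R (deriv ^^ Suc k) ?h (of_real t))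
      has_integral ?h (of_real T) - (\<Sum>i<Suc k. ((T - 0) ^ i / fact i) *\<^sub>R (deriv ^^ i) ?h (of_real 0)))
      {0..T}"
  proof (rule Taylor_has_integral)
    show "((\<lambda>t. (deriv ^^ m) ?h (of_real t)) has_vector_derivative (deriv ^^ Suc m) ?h (of_real t))
        (at t within {0..T})" for m t
      by (intro has_vector_derivative_real_field has_field_derivative_higher_deriv[of _ UNIV])
        (auto intro!: holomorphic_intros)
  qed (use assms in auto)
  moreover have "(deriv ^^ i) ?h 0 = (if i = k then fact k else 0)" if "i < Suc k" for i
  proof -
    have "(deriv ^^ i) ?h 0 = (\<Sum>j\<le>i. if j = k then fact k else 0)"
      unfolding higher_deriv_power_mult_exp
      by (rule sum.cong[OF refl]) (use that in \<open>auto simp: power_0_left pochhammer_fact le_less_Suc_eq\<close>)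
    then show ?thesis
      using that by auto
  qed
  then have "(\<Sum>i<Suc k. ((T - 0) ^ i / fact i) *\<^sub>R (deriv ^^ i) ?h (of_real 0)) =
      (\<Sum>i<Suc k. if i = k then of_real (T ^ k) else 0)"
    by (intro sum.cong) (auto simp: scaleR_conv_of_real)
  ultimately show ?thesis
    by (simp add: scaleR_conv_of_real del: funpow.simps)
qed

lemma power_over_fact_le_exp:
  fixes x :: real
  assumes "0 \<le> x"
  shows "x ^ i / fact i \<le> exp x"
proof -
  have "(\<Sum>n\<in>{i}. inverse (fact n) *\<^sub>R x ^ n) \<le> exp x"
    unfolding exp_def by (rule sum_le_suminf[OF summable_exp_generic]) (use assms in auto)
  then show ?thesis
    by (simp add: field_simps)
qed

text \<open>The left side is the size of the kernel in the shift formula, with \<open>t + y\<close>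
  as the summation parameter. The right side is a constant times
  \<open>Re w / 2 * exp (- (Re w * y / 2))\<close>, a density in \<open>y\<close> of total mass 1 on
  the half-line; hence the later bound does not depend on the parameter. The Leibniz terms are
  estimated one by one and resummed by the binomial theorem.\<close>

lemma higher_deriv_power_mult_exp_bound:
  fixes w :: complex and t y :: real
  assumes "0 \<le> t" "0 \<le> y" "0 < t + y" "0 < Re w"
  shows "exp (- (Re w * (t + y))) * (y / (t + y)) ^ k *
      cmod ((deriv ^^ Suc k) (\<lambda>z. z ^ k * exp (w * z)) (of_real t)) / fact k
    \<le> (1 + 2 * (cmod w / Re w)) ^ Suc k * (Re w / 2 * exp (- (Re w * y / 2)))"
proof -
  define u K where "u = Re w" and "K = cmod w / Re w"
  define E where "E = exp (- (u * (t + y))) * (y / (t + y)) ^ k / fact k"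
  define p where "p j = (pochhammer (of_nat (Suc k - j)) j :: complex)" for j
  have u: "0 < u" and w: "cmod w = K * u" and K: "0 \<le> K"
    using assms by (auto simp: u_def K_def)
  have E: "0 \<le> E"
    using assms by (simp add: E_def)
  have term_le: "E * (cmod (p j) * t ^ (k - j) * (cmod w ^ (Suc k - j) * exp (u * t)))
      \<le> (2 * K) ^ (Suc k - j) * (u / 2 * exp (- (u * y / 2)))" if "j \<le> Suc k" for j
  \<comment> \<open>At \<open>j = Suc k\<close> the falling factorial is zero, so the truncated
    exponent \<open>k - j\<close> does no harm.\<close>
  proof (cases "j = Suc k")
    case True
    then show ?thesis
      using u by (simp add: p_def pochhammer_0_left)
  next
    case False
    define i where "i = k - j"
    have j: "j \<le> k" "Suc k - j = Suc i" "i \<le> k"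
      using that False by (auto simp: i_def)
    have pj: "cmod (p j) = fact k / fact i"
      unfolding p_def pochhammer_eq_fact_div[OF j(1)] i_def by (simp add: norm_divide)
    \<comment> \<open>Of the \<open>k\<close> factors \<open>y / (t + y)\<close>, all at most 1,
      only \<open>i\<close> are kept; each of them turns one factor \<open>t\<close> into at most
      \<open>y\<close>.\<close>
    have "(y / (t + y)) ^ k * t ^ i \<le> (y / (t + y)) ^ i * t ^ i"
      using assms j by (intro mult_right_mono power_decreasing) auto
    also have "\<dots> = (y * (t / (t + y))) ^ i"
      by (simp add: power_mult_distrib power_divide)
    also have "\<dots> \<le> (y * 1) ^ i"
      using assms by (intro power_mono mult_left_mono) auto
    finally have yt: "(y / (t + y)) ^ k * t ^ i \<le> y ^ i"
      by simp
    have "E * (cmod (p j) * t ^ i * (cmod w ^ Suc i * exp (u * t))) =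
        ((y / (t + y)) ^ k * t ^ i) * (K ^ Suc i * u ^ Suc i * exp (- (u * y)) / fact i)"
      unfolding E_def pj w power_mult_distrib
      by (simp add: field_simps flip: exp_add)
    also have "\<dots> \<le> y ^ i * (K ^ Suc i * u ^ Suc i * exp (- (u * y)) / fact i)"
      using yt u K by (intro mult_right_mono) auto
    \<comment> \<open>Half of the decay \<open>exp (- (u * y))\<close> is spent on absorbing
      \<open>y ^ i\<close>; the halving is the source of the 2 in \<open>2 * K\<close>.\<close>
    also have "\<dots> = (2 * K) ^ Suc i * (u / 2) * ((u * y / 2) ^ i / fact i) * exp (- (u * y))"
      by (simp add: power_mult_distrib power_divide)
    also have "\<dots> \<le> (2 * K) ^ Suc i * (u / 2) * exp (u * y / 2) * exp (- (u * y))"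
      using u K assms
      by (intro mult_right_mono mult_left_mono power_over_fact_le_exp) auto
    also have "\<dots> = (2 * K) ^ Suc i * (u / 2 * exp (- (u * y / 2)))"
      by (simp flip: exp_add)
    finally show ?thesis
      unfolding j(2) i_def .
  qed
  have "cmod ((deriv ^^ Suc k) (\<lambda>z. z ^ k * exp (w * z)) (of_real t)) \<le>
      (\<Sum>j\<le>Suc k. real (Suc k choose j) *
        (cmod (p j) * t ^ (k - j) * (cmod w ^ (Suc k - j) * exp (u * t))))"
    unfolding higher_deriv_power_mult_exp p_def[symmetric]
    by (rule sum_norm_le) (use assms in \<open>simp add: norm_mult norm_power u_def\<close>)
  from mult_left_mono[OF this E]
  have "E * cmod ((deriv ^^ Suc k) (\<lambda>z. z ^ k * exp (w * z)) (of_real t)) \<le>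
      (\<Sum>j\<le>Suc k. real (Suc k choose j) *
        (E * (cmod (p j) * t ^ (k - j) * (cmod w ^ (Suc k - j) * exp (u * t)))))"
    by (simp add: sum_distrib_left mult_ac del: sum.atMost_Suc)
  also have "\<dots> \<le> (\<Sum>j\<le>Suc k. real (Suc k choose j) *
        ((2 * K) ^ (Suc k - j) * (u / 2 * exp (- (u * y / 2)))))"
    by (intro sum_mono mult_left_mono term_le) auto
  also have "\<dots> = (1 + 2 * K) ^ Suc k * (u / 2 * exp (- (u * y / 2)))"
    unfolding binomial_ring[of 1 "2 * K" "Suc k"] sum_distrib_right
    by (simp add: mult.assoc del: sum.atMost_Suc)
  finally show ?thesis
    unfolding E_def u_def K_def by (simp add: mult_ac)
qed

section \<open>Riesz means under a shift of the argument\<close>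

text \<open>Summing the Taylor formulas for \<open>T = x - lam n\<close> against the coefficients
  writes the mean at \<open>s + w\<close> as \<open>exp (- (w * x))\<close> times the mean at
  \<open>s\<close>, plus an integral over the means at \<open>s\<close> with parameters
  \<open>x - t\<close>. All of these are at most \<open>M\<close>, and the kernel bound controls the
  rest.\<close>

lemma riesz_mean_shift_bound:
  assumes lam: "frequency lam" and "0 < k" and w: "0 < Re w"
    and M: "\<And>y. cmod (riesz_mean lam a (real k) y s) \<le> M"
  shows "cmod (riesz_mean lam a (real k) x (s + w)) \<le> M * (1 + 2 * (cmod w / Re w)) ^ Suc k"
proof (cases "x \<le> 0")
  case True
  have "0 \<le> M"
    using M[of 0] norm_ge_zero order_trans by blast
  then show ?thesis
    using w by (simp add: riesz_mean_nonpos[OF lam True])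
next
  case False
  then have x: "0 < x" by simp
  have "0 \<le> M"
    using M[of 0] norm_ge_zero order_trans by blast
  define u Q where "u = Re w" and "Q = (1 + 2 * (cmod w / Re w)) ^ Suc k"
  have u: "0 < u" and Q: "1 \<le> Q"
    using w by (auto simp: u_def Q_def intro!: one_le_power simp del: power_Suc)
  define c where "c n = a n * exp (- of_real (lam n) * s)" for n
  define H where "H t = (deriv ^^ Suc k) (\<lambda>z. z ^ k * exp (w * z)) (complex_of_real t)" for t
  define R where "R y = riesz_mean lam a (real k) y s" for y
  define S where "S y = R y * of_real y ^ k" for y
  have S: "S y = (\<Sum>n | lam n < y. c n * of_real ((y - lam n) ^ k))" if "0 \<le> y" for y
    using riesz_mean_of_nat[OF lam that, of a k s] by (simp add: S_def R_def c_def)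
  have fin: "finite {n. lam n < y}" for y
    by (rule finite_frequency_below[OF lam])
  have lam0: "0 \<le> lam n" for n
    using lam by (simp add: frequency_def)
  let ?g = "\<lambda>n t. of_real ((x - lam n - t) ^ k / fact k) * H t"
  \<comment> \<open>Extension by zero from \<open>{0..x - lam n}\<close> to \<open>{0..x}\<close>
    puts all indices on one interval, so that the integrals can be added.\<close>
  have "((\<lambda>t. if t \<in> {0..x - lam n} then ?g n t else 0) has_integral
      of_real ((x - lam n) ^ k) * exp (w * of_real (x - lam n)) - of_real ((x - lam n) ^ k)) {0..x}"
    if "lam n < x" for n
    unfolding H_def using that lam0[of n]
    by (subst has_integral_restrict) (auto intro!: power_mult_exp_Taylor
        simp del: funpow.simps of_real_power of_real_diff of_real_divide)
  then have "((\<lambda>t. \<Sum>n | lam n < x. c n * (if t \<in> {0..x - lam n} then ?g n t else 0)) has_integral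
      (\<Sum>n | lam n < x. c n * (of_real ((x - lam n) ^ k) * exp (w * of_real (x - lam n))
         - of_real ((x - lam n) ^ k)))) {0..x}"
    by (intro has_integral_sum fin has_integral_mult_right) blast
  also have "(\<Sum>n | lam n < x. c n * (of_real ((x - lam n) ^ k) * exp (w * of_real (x - lam n))
         - of_real ((x - lam n) ^ k))) =
      (riesz_mean lam a (real k) x (s + w) * exp (w * of_real x) - R x) * of_real x ^ k"
  proof -
    have "riesz_mean lam a (real k) x (s + w) * of_real x ^ k * exp (w * of_real x) =
        (\<Sum>n | lam n < x. c n * of_real ((x - lam n) ^ k) * exp (w * of_real (x - lam n)))"
    proof -
      \<comment> \<open>The factor \<open>exp (w * x)\<close> completes
        \<open>exp (- lam n * w)\<close> to the exponential at \<open>T = x - lam n\<close>, as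
        Taylor's formula requires.\<close>
      have exp_eq: "exp (- of_real (lam n) * (s + w)) * exp (w * of_real x) =
          exp (- of_real (lam n) * s) * exp (w * of_real (x - lam n))" for n
        by (simp add: algebra_simps flip: exp_add)
      have "a n * exp (- of_real (lam n) * (s + w)) * t * exp (w * of_real x) =
          c n * t * exp (w * of_real (x - lam n))" for n t
      proof -
        have "a n * exp (- of_real (lam n) * (s + w)) * t * exp (w * of_real x) =
            a n * (exp (- of_real (lam n) * (s + w)) * exp (w * of_real x)) * t"
          by (simp only: mult_ac)
        also have "\<dots> = c n * t * exp (w * of_real (x - lam n))"
          unfolding exp_eq c_def by (simp only: mult_ac)
        finally show ?thesis .
      qed
      then show ?thesis
        unfolding riesz_mean_of_nat[OF lam less_imp_le[OF x]] sum_distrib_right by (simp only:)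
    qed
    then show ?thesis
      using S[of x] x by (simp add: S_def sum_subtractf algebra_simps)
  qed
  finally have int: "((\<lambda>t. \<Sum>n | lam n < x. c n * (if t \<in> {0..x - lam n} then ?g n t else 0))
      has_integral (riesz_mean lam a (real k) x (s + w) * exp (w * of_real x) - R x) * of_real x ^ k)
      {0..x}" .
  \<comment> \<open>The cut-off \<open>t \<le> x - lam n\<close> reads
    \<open>lam n \<le> x - t\<close>, so the sum over indices reassembles the unnormalised mean
    \<open>S\<close> at \<open>x - t\<close>.\<close>
  have eq: "(\<Sum>n | lam n < x. c n * (if t \<in> {0..x - lam n} then ?g n t else 0)) =
      S (x - t) / fact k * H t" if t: "t \<in> {0..x}" for t
  proof -
    have "0 \<le> x - t"
      using t by simp
    then have "S (x - t) / fact k * H t =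
        (\<Sum>n | lam n < x - t. c n * (if t \<in> {0..x - lam n} then ?g n t else 0))"
      unfolding S[OF \<open>0 \<le> x - t\<close>] sum_divide_distrib sum_distrib_right
      using t by (intro sum.cong) (auto simp: algebra_simps)
    also have "\<dots> = (\<Sum>n | lam n < x. c n * (if t \<in> {0..x - lam n} then ?g n t else 0))"
    proof (rule sum.mono_neutral_left[OF fin])
      \<comment> \<open>An index with \<open>lam n = x - t\<close> passes the closed cut-off but is
        not counted in \<open>S (x - t)\<close>; its term is \<open>0 ^ k\<close>, which vanishes
        because \<open>k\<close> is positive.\<close>
      have "?g n t = 0" if "\<not> lam n < x - t" "t \<le> x - lam n" for n
      proof -
        have "x - lam n - t = 0"
          using that by linarith
        then show ?thesis
          using \<open>0 < k\<close> by (simp only:) simp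
      qed
      then show "\<forall>n\<in>{n. lam n < x} - {n. lam n < x - t}.
          c n * (if t \<in> {0..x - lam n} then ?g n t else 0) = 0"
        using t by (auto simp del: of_real_diff of_real_power of_real_divide)
    qed (use t in auto)
    finally show ?thesis ..
  qed
  have "((\<lambda>t. exp (- (w * of_real x)) / of_real x ^ k * (S (x - t) / fact k * H t)) has_integral
      exp (- (w * of_real x)) / of_real x ^ k *
        ((riesz_mean lam a (real k) x (s + w) * exp (w * of_real x) - R x) * of_real x ^ k)) {0..x}"
    by (intro has_integral_mult_right has_integral_eq[OF eq int])
  also have "exp (- (w * of_real x)) / of_real x ^ k *
        ((riesz_mean lam a (real k) x (s + w) * exp (w * of_real x) - R x) * of_real x ^ k) =
      riesz_mean lam a (real k) x (s + w) - exp (- (w * of_real x)) * R x"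
    using x by (simp add: field_simps exp_minus)
  finally have int': "((\<lambda>t. exp (- (w * of_real x)) / of_real x ^ k * (S (x - t) / fact k * H t))
      has_integral riesz_mean lam a (real k) x (s + w) - exp (- (w * of_real x)) * R x) {0..x}" .
  have "((\<lambda>t. u / 2 * exp (- (u * (x - t) / 2))) has_integral
      exp (- (u * (x - x) / 2)) - exp (- (u * (x - 0) / 2))) {0..x}"
    using x by (intro fundamental_theorem_of_calculus)
      (auto simp flip: has_real_derivative_iff_has_vector_derivative intro!: derivative_eq_intros)
  from has_integral_mult_right[OF this, of "M * Q"]
  have bound: "((\<lambda>t. M * Q * (u / 2 * exp (- (u * (x - t) / 2)))) has_integral
      M * Q * (1 - exp (- (u * x / 2)))) {0..x}"
    by simp
  have "cmod (exp (- (w * of_real x)) / of_real x ^ k * (S (x - t) / fact k * H t))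
      \<le> M * Q * (u / 2 * exp (- (u * (x - t) / 2)))" if t: "t \<in> {0..x}" for t
  proof -
    have "cmod (exp (- (w * of_real x)) / of_real x ^ k * (S (x - t) / fact k * H t)) =
        cmod (R (x - t)) * (exp (- (u * x)) * ((x - t) / x) ^ k * cmod (H t) / fact k)"
      using x t by (simp add: S_def norm_mult norm_divide norm_power u_def power_divide
          flip: of_real_diff)
    also have "\<dots> \<le> M * (Q * (u / 2 * exp (- (u * (x - t) / 2))))"
      using higher_deriv_power_mult_exp_bound[of t "x - t" w k] t x w \<open>0 \<le> M\<close>
      unfolding R_def H_def
      by (intro mult_mono M) (auto simp: u_def Q_def simp del: funpow.simps power_Suc)
    finally show ?thesis
      by (simp add: mult_ac)
  qed
  then have "cmod (riesz_mean lam a (real k) x (s + w) - exp (- (w * of_real x)) * R x)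
      \<le> M * Q * (1 - exp (- (u * x / 2)))"
    using integral_norm_bound_integral[OF has_integral_integrable[OF int']
        has_integral_integrable[OF bound]]
    unfolding integral_unique[OF int'] integral_unique[OF bound] by blast
  \<comment> \<open>The integral left the weight \<open>1 - exp (- (u * x / 2))\<close>. Weakening
    the boundary term to the complementary weight makes the two add up to exactly
    \<open>M * Q\<close>.\<close>
  moreover have "cmod (exp (- (w * of_real x)) * R x) \<le> exp (- (u * x / 2)) * (M * Q)"
  proof -
    have "cmod (exp (- (w * of_real x)) * R x) = exp (- (u * x)) * cmod (R x)"
      by (simp add: norm_mult u_def)
    also have "\<dots> \<le> exp (- (u * x / 2)) * (M * Q)"
      using u x Q M[of x] \<open>0 \<le> M\<close> mult_left_mono[OF Q \<open>0 \<le> M\<close>]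
      by (intro mult_mono) (auto simp: R_def)
    finally show ?thesis .
  qed
  ultimately have "cmod (riesz_mean lam a (real k) x (s + w))
      \<le> M * Q * (1 - exp (- (u * x / 2))) + exp (- (u * x / 2)) * (M * Q)"
    using norm_triangle_sub[of "riesz_mean lam a (real k) x (s + w)" "exp (- (w * of_real x)) * R x"]
    by linarith
  also have "\<dots> = M * Q"
    by (simp add: algebra_simps)
  finally show ?thesis
    unfolding Q_def .
qed

section \<open>Boundedness of convergent means and passage to higher orders\<close>

text \<open>Convergence bounds the means from some \<open>Y\<close> on. Below \<open>Y\<close> only
  the finitely many indices with \<open>lam n < Y\<close> can occur, and their weights are at most
  1.\<close>

lemma riesz_mean_bounded:
  assumes lam: "frequency lam" and "0 \<le> m"
    and conv: "((\<lambda>x. riesz_mean lam a m x s) \<longlongrightarrow> L) at_top"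
  obtains M where "\<And>x. cmod (riesz_mean lam a m x s) \<le> M"
proof -
  have "eventually (\<lambda>x. dist (riesz_mean lam a m x s) L < 1) at_top"
    using conv by (rule tendstoD) simp
  then obtain Y where Y: "\<And>x. x \<ge> Y \<Longrightarrow> dist (riesz_mean lam a m x s) L < 1"
    by (auto simp: eventually_at_top_linorder)
  define B where "B = (\<Sum>n | lam n < Y. cmod (a n * exp (- of_real (lam n) * s)))"
  have B: "0 \<le> B"
    by (auto simp: B_def intro: sum_nonneg)
  have "cmod (riesz_mean lam a m x s) \<le> B + cmod L + 1" for x
  proof (cases "x \<ge> Y")
    case True
    then have "cmod (riesz_mean lam a m x s) \<le> cmod L + 1"
      using Y[of x] norm_triangle_sub[of "riesz_mean lam a m x s" L] by (auto simp: dist_norm)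
    then show ?thesis
      using B by simp
  next
    case False
    show ?thesis
    proof (cases "x \<le> 0")
      case True
      then show ?thesis
        using B by (simp add: riesz_mean_nonpos[OF lam])
    next
      case x: False
      have "cmod (riesz_mean lam a m x s) \<le>
          (\<Sum>n | lam n < x. cmod (a n * exp (- of_real (lam n) * s)))"
        unfolding riesz_mean_def
      proof (rule sum_norm_le)
        fix n assume "n \<in> {n. lam n < x}"
        then have "0 < 1 - lam n / x" "1 - lam n / x \<le> 1"
          using x lam by (auto simp: frequency_def)
        then have "(1 - lam n / x) powr m \<le> 1"
          using \<open>0 \<le> m\<close> by (intro powr_le1) auto
        then show "cmod (a n * exp (- of_real (lam n) * s) * of_real ((1 - lam n / x) powr m)) \<le>
            cmod (a n * exp (- of_real (lam n) * s))"
          unfolding norm_mult norm_of_real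
          by (intro mult_right_le_one_le) auto
      qed
      also have "\<dots> \<le> B"
        unfolding B_def by (rule sum_mono2[OF finite_frequency_below[OF lam]]) (use False in auto)
      finally show ?thesis
        using norm_ge_zero[of L] by linarith
    qed
  qed
  then show thesis
    by (rule that)
qed

text \<open>The substitution \<open>v = q + (1 - q) * t\<close> reduces this to Euler's Beta
  integral. The integrand is homogeneous of degree \<open>a + b - 2\<close> in \<open>1 - q\<close>,
  and the Jacobian adds 1.\<close>

lemma has_integral_Beta_shifted:
  fixes q a b :: real
  assumes "0 < a" "0 < b" "0 \<le> q" "q < 1"
  shows "((\<lambda>v. if q < v then (v - q) powr (a - 1) * (1 - v) powr (b - 1) else 0)
    has_integral Beta a b * (1 - q) powr (a + b - 1)) {0..1}"
proof -
  define c where "c = 1 - q"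
  have c: "0 < c"
    using assms by (simp add: c_def)
  let ?f = "\<lambda>t. t powr (a - 1) * (1 - t) powr (b - 1)"
  have "(?f has_integral Beta a b) (cbox 0 1)"
    using has_integral_Beta_real[OF assms(1,2)] by simp
  from has_integral_affinity'[OF this, of "1 / c" "- q / c"]
  have "((\<lambda>v. ?f ((v - q) / c)) has_integral c * Beta a b)
      (cbox ((0 - - q / c) /\<^sub>R (1 / c)) ((1 - - q / c) /\<^sub>R (1 / c)))"
    using c by (simp add: diff_divide_distrib)
  also have "cbox ((0 - - q / c) /\<^sub>R (1 / c)) ((1 - - q / c) /\<^sub>R (1 / c)) = {q..1}"
    using c by (simp add: distrib_left) (simp add: c_def)
  finally have "((\<lambda>v. ?f ((v - q) / c)) has_integral c * Beta a b) {q..1}" .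
  from has_integral_mult_right[OF this, of "c powr (a + b - 2)"]
  have "((\<lambda>v. c powr (a + b - 2) * ?f ((v - q) / c)) has_integral
      Beta a b * c powr (a + b - 1)) {q..1}"
    using c powr_add[of c "a + b - 2" 1] by (simp add: mult_ac)
  moreover have "c powr (a + b - 2) * ?f ((v - q) / c) =
      (if q < v then (v - q) powr (a - 1) * (1 - v) powr (b - 1) else 0)" if "v \<in> {q..1}" for v
  proof -
    have "1 - (v - q) / c = (1 - v) / c"
      using c by (simp add: diff_divide_distrib[symmetric] divide_simps) (simp add: c_def)
    moreover have "c powr (a + b - 2) = c powr (a - 1) * c powr (b - 1)"
      by (simp flip: powr_add)
    ultimately show ?thesis
      using that c by (auto simp: powr_divide)
  qed
  ultimately have "((\<lambda>v. if q < v then (v - q) powr (a - 1) * (1 - v) powr (b - 1) else 0)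
    has_integral Beta a b * c powr (a + b - 1)) {q..1}"
    by (rule has_integral_eq[rotated])
  then have "((\<lambda>v. if v \<in> {q..1} then
      (if q < v then (v - q) powr (a - 1) * (1 - v) powr (b - 1) else 0) else 0)
    has_integral Beta a b * c powr (a + b - 1)) {0..1}"
    using assms by (subst has_integral_restrict) auto
  then show ?thesis
    unfolding c_def by (rule has_integral_eq[rotated]) auto
qed

text \<open>Up to normalisation, a mean of higher order is a Beta average of the means of order
  \<open>m\<close> over \<open>{0..x}\<close>. Termwise this is the shifted Beta integral with
  \<open>q = lam n / x\<close>: the factor \<open>v powr m\<close> turns the weight at
  \<open>x * v\<close> into \<open>(v - q) powr m\<close>, and the cut-off \<open>q < v\<close>
  selects the indices with \<open>lam n < x * v\<close>.\<close>

lemma riesz_mean_higher_order_integral: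
  assumes lam: "frequency lam" and "0 \<le> m" "m < k" and x: "0 < x"
  shows "((\<lambda>v. of_real (v powr m * (1 - v) powr (k - m - 1)) * riesz_mean lam a m (x * v) s)
    has_integral of_real (Beta (m + 1) (k - m)) * riesz_mean lam a k x s) {0..1}"
proof -
  define c where "c n = a n * exp (- of_real (lam n) * s)" for n
  define g where "g n v = (if lam n / x < v
    then (v - lam n / x) powr m * (1 - v) powr (k - m - 1) else 0)" for n v
  have "((\<lambda>v. \<Sum>n | lam n < x. c n * of_real (g n v)) has_integral
      (\<Sum>n | lam n < x. c n * of_real (Beta (m + 1) (k - m) * (1 - lam n / x) powr k))) {0..1}"
  proof (intro has_integral_sum finite_frequency_below[OF lam] has_integral_mult_right
      has_integral_of_real)
    fix n assume "n \<in> {n. lam n < x}"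
    then show "(g n has_integral Beta (m + 1) (k - m) * (1 - lam n / x) powr k) {0..1}"
      using has_integral_Beta_shifted[of "m + 1" "k - m" "lam n / x",
          unfolded add_diff_cancel_right'] assms
      unfolding g_def by (simp add: frequency_def)
  qed
  also have "(\<Sum>n | lam n < x. c n * of_real (Beta (m + 1) (k - m) * (1 - lam n / x) powr k)) =
      of_real (Beta (m + 1) (k - m)) * riesz_mean lam a k x s"
    unfolding riesz_mean_def sum_distrib_left c_def by (intro sum.cong) auto
  finally show ?thesis
  proof (rule has_integral_eq[rotated])
    fix v :: real assume v: "v \<in> {0..1}"
    have "of_real (v powr m * (1 - v) powr (k - m - 1)) * riesz_mean lam a m (x * v) s =
        (\<Sum>n | lam n < x * v. c n * of_real (g n v))"
      unfolding riesz_mean_def sum_distrib_left c_def[symmetric]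
    proof (intro sum.cong refl)
      fix n assume "n \<in> {n. lam n < x * v}"
      then have n: "lam n < x * v" by simp
      moreover have "0 \<le> lam n"
        using lam by (simp add: frequency_def)
      ultimately have "0 < v"
        using x v by (smt (verit) zero_less_mult_pos)
      have "v powr m * (1 - lam n / (x * v)) powr m = (v * (1 - lam n / (x * v))) powr m"
        using n x \<open>0 < v\<close> by (subst powr_mult) auto
      also have "v * (1 - lam n / (x * v)) = v - lam n / x"
        using x \<open>0 < v\<close> by (simp add: field_simps)
      finally have "v powr m * (1 - lam n / (x * v)) powr m = (v - lam n / x) powr m" .
      moreover have "lam n / x < v"
        using n x by (simp add: field_simps)
      ultimately have "g n v = v powr m * (1 - v) powr (k - m - 1) * (1 - lam n / (x * v)) powr m"
        by (simp add: g_def)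
      then show "of_real (v powr m * (1 - v) powr (k - m - 1)) *
          (c n * of_real ((1 - lam n / (x * v)) powr m)) = c n * of_real (g n v)"
        by simp
    qed
    also have "\<dots> = (\<Sum>n | lam n < x. c n * of_real (g n v))"
    proof (rule sum.mono_neutral_left[OF finite_frequency_below[OF lam]])
      have "x * v \<le> x"
        using v x by (simp add: mult_left_le)
      then show "{n. lam n < x * v} \<subseteq> {n. lam n < x}"
        by auto
    qed (use x in \<open>auto simp: g_def field_simps\<close>)
    finally show "(\<Sum>n | lam n < x. c n * of_real (g n v)) =
      of_real (v powr m * (1 - v) powr (k - m - 1)) * riesz_mean lam a m (x * v) s" ..
  qed
qed

text \<open>The first theorem of consistency for Riesz summability. In the Beta average the means at
  \<open>x * v\<close> tend to \<open>L\<close> for each \<open>v > 0\<close>, and their boundedness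
  supplies an integrable majorant.\<close>

lemma riesz_mean_tendsto_higher_order:
  assumes lam: "frequency lam" and m: "0 \<le> m" "m < k"
    and conv: "((\<lambda>x. riesz_mean lam a m x s) \<longlongrightarrow> L) at_top"
  shows "((\<lambda>x. riesz_mean lam a k x s) \<longlongrightarrow> L) at_top"
proof (rule tendsto_at_topI_sequentially)
  \<comment> \<open>Dominated convergence is a statement about sequences, so the limit is tested
    along arbitrary sequences tending to infinity.\<close>
  fix X :: "nat \<Rightarrow> real" assume X: "filterlim X at_top sequentially"
  obtain M where M: "\<And>x. cmod (riesz_mean lam a m x s) \<le> M"
    using riesz_mean_bounded[OF lam m(1) conv] by blast
  define h where "h v = v powr m * (1 - v) powr (k - m - 1)" for v :: real
  define \<beta> where "\<beta> = complex_of_real (Beta (m + 1) (k - m))"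
  have h: "(h has_integral Beta (m + 1) (k - m)) {0..1}"
    using has_integral_Beta_real[of "m + 1" "k - m"] m by (simp add: h_def[abs_def])
  have "0 < Beta (m + 1) (k - m)"
    using m by (simp add: Beta_def)
  then have \<beta>: "\<beta> \<noteq> 0"
    by (simp add: \<beta>_def)
  \<comment> \<open>The integral formula needs a positive argument, which \<open>X i\<close> has only eventually.\<close>
  define Y where "Y i = max 1 (X i)" for i
  have Y: "filterlim Y at_top sequentially" and Y1: "1 \<le> Y i" for i
    using filterlim_at_top_mono[OF X, of Y] by (auto simp: Y_def[abs_def])
  have int: "((\<lambda>v. of_real (h v) * riesz_mean lam a m (Y i * v) s) has_integral
      \<beta> * riesz_mean lam a k (Y i) s) {0..1}" for i
    using riesz_mean_higher_order_integral[OF lam m, of "Y i" a s] Y1[of i]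
    by (simp add: h_def \<beta>_def)
  have "(\<lambda>i. integral {0..1} (\<lambda>v. of_real (h v) * riesz_mean lam a m (Y i * v) s)) \<longlonglongrightarrow>
      integral {0..1} (\<lambda>v. of_real (h v) * L)"
  proof (rule dominated_convergence(2))
    show "(\<lambda>v. of_real (h v) * riesz_mean lam a m (Y i * v) s) integrable_on {0..1}" for i
      using int by (auto simp: integrable_on_def)
    show "(\<lambda>v. h v * M) integrable_on {0..1}"
      using has_integral_mult_left[OF h] by (auto simp: integrable_on_def)
    show "cmod (of_real (h v) * riesz_mean lam a m (Y i * v) s) \<le> h v * M" if "v \<in> {0..1}" for i v
      using M[of "Y i * v"] by (simp add: norm_mult h_def mult_left_mono)
    show "(\<lambda>i. of_real (h v) * riesz_mean lam a m (Y i * v) s) \<longlonglongrightarrow> of_real (h v) * L"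
      if "v \<in> {0..1}" for v
    \<comment> \<open>At \<open>v = 0\<close> the parameter stays at 0 instead of growing, but there
      \<open>h\<close> is zero: \<open>0 powr m = 0\<close>, also for \<open>m = 0\<close>.\<close>
    proof (cases "v = 0")
      case True
      then show ?thesis by (simp add: h_def)
    next
      case False
      then have "filterlim (\<lambda>i. v * Y i) at_top sequentially"
        using that by (intro filterlim_tendsto_pos_mult_at_top[OF tendsto_const _ Y]) auto
      then have "filterlim (\<lambda>i. Y i * v) at_top sequentially"
        by (simp add: mult.commute)
      then show ?thesis
        by (intro tendsto_mult tendsto_const filterlim_compose[OF conv])
    qed
  qed
  moreover have "integral {0..1} (\<lambda>v. of_real (h v) * L) = \<beta> * L"
    unfolding \<beta>_def by (intro integral_unique has_integral_mult_left has_integral_of_real h)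
  ultimately have "(\<lambda>i. \<beta> * riesz_mean lam a k (Y i) s) \<longlonglongrightarrow> \<beta> * L"
    unfolding integral_unique[OF int] by (simp only:)
  from tendsto_mult_left[OF this, of "inverse \<beta>"]
  have "(\<lambda>i. riesz_mean lam a k (Y i) s) \<longlonglongrightarrow> L"
    using \<beta> by (simp flip: mult.assoc)
  moreover have "eventually (\<lambda>i. Y i = X i) sequentially"
    using eventually_compose_filterlim[OF eventually_ge_at_top[of 1] X]
    by eventually_elim (auto simp: Y_def)
  then have "eventually (\<lambda>i. riesz_mean lam a k (Y i) s = riesz_mean lam a k (X i) s) sequentially"
    by eventually_elim simp
  ultimately show "(\<lambda>i. riesz_mean lam a k (X i) s) \<longlonglongrightarrow> L"
    by (rule Lim_transform_eventually)
qed

section \<open>Consequences of a Riesz germ: boundedness on a sector, and translation\<close>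

text \<open>Seen from a fixed point \<open>s0\<close> of convergence, the far part of the sector
  consists of points \<open>s0 + w\<close> with \<open>cmod w / Re w\<close> bounded. The shift
  bound is then uniform in \<open>s\<close> and in the parameter, and survives the limit.\<close>

lemma riesz_germ_bounded_on_sector:
  assumes lam: "frequency lam" and "has_riesz_germ lam f"
  obtains C r where "0 < C" "1 \<le> r"
    "\<And>s. r \<le> Re s \<Longrightarrow> \<bar>Im s\<bar> \<le> Re s \<Longrightarrow> cmod (f s) \<le> C"
proof -
  obtain a m \<sigma> where m: "0 \<le> m" and \<sigma>: "0 \<le> \<sigma>"
    and conv: "\<And>s. \<sigma> < Re s \<Longrightarrow> ((\<lambda>x. riesz_mean lam a m x s) \<longlongrightarrow> f s) at_top"
    using assms(2) unfolding has_riesz_germ_def riesz_germ_def half_plane_def by blast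
  \<comment> \<open>An integer order strictly above \<open>m\<close>, as consistency demands, and
    positive, as the shift bound demands.\<close>
  define k where "k = Suc (nat \<lceil>m\<rceil>)"
  have "m < real k"
    unfolding k_def by linarith
  then have conv': "((\<lambda>x. riesz_mean lam a (real k) x s) \<longlongrightarrow> f s) at_top" if "\<sigma> < Re s" for s
    using riesz_mean_tendsto_higher_order[OF lam m _ conv[OF that]] by blast
  define s0 where "s0 = complex_of_real (\<sigma> + 1)"
  obtain M where M: "\<And>x. cmod (riesz_mean lam a (real k) x s0) \<le> M"
    using riesz_mean_bounded[OF lam _ conv'[of s0]] by (auto simp: s0_def)
  have "0 \<le> M"
    using M[of 0] norm_ge_zero order_trans by blast
  \<comment> \<open>From \<open>Re s \<ge> 2 * (\<sigma> + 1)\<close> follows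
    \<open>Re w \<ge> Re s / 2\<close>, so \<open>cmod w \<le> 3 * Re w\<close> and the base is at
    most \<open>1 + 2 * 3 = 7\<close>. The summand 1 keeps the constant positive if
    \<open>M = 0\<close>.\<close>
  have "cmod (f s) \<le> M * 7 ^ Suc k + 1" if s: "2 * (\<sigma> + 1) \<le> Re s" "\<bar>Im s\<bar> \<le> Re s" for s
  proof -
    define w where "w = s - s0"
    have w: "Re s \<le> 2 * Re w" "0 < Re w" "Im w = Im s"
      using s \<sigma> by (auto simp: w_def s0_def)
    have "cmod w \<le> 3 * Re w"
      using cmod_le[of w] w s by linarith
    then have "1 + 2 * (cmod w / Re w) \<le> 7"
      using w by (simp add: field_simps)
    then have *: "(1 + 2 * (cmod w / Re w)) ^ Suc k \<le> 7 ^ Suc k"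
      using w by (intro power_mono) auto
    have "cmod (riesz_mean lam a (real k) x s) \<le> M * 7 ^ Suc k" for x
    proof -
      have "cmod (riesz_mean lam a (real k) x (s0 + w)) \<le> M * (1 + 2 * (cmod w / Re w)) ^ Suc k"
        using w by (intro riesz_mean_shift_bound[OF lam _ _ M]) (auto simp: k_def)
      also have "\<dots> \<le> M * 7 ^ Suc k"
        using * \<open>0 \<le> M\<close> by (rule mult_left_mono)
      finally show ?thesis
        by (simp add: w_def)
    qed
    moreover have "((\<lambda>x. cmod (riesz_mean lam a (real k) x s)) \<longlongrightarrow> cmod (f s)) at_top"
      using s \<sigma> by (intro tendsto_norm conv') auto
    ultimately have "cmod (f s) \<le> M * 7 ^ Suc k"
      by (intro tendsto_upperbound[where F = at_top]) auto
    then show ?thesis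
      by simp
  qed
  moreover have "0 < M * 7 ^ Suc k + 1"
    using \<open>0 \<le> M\<close> by (simp add: add_nonneg_pos)
  ultimately show thesis
    using \<sigma> by (intro that[of "M * 7 ^ Suc k + 1" "2 * (\<sigma> + 1)"]) auto
qed

text \<open>The factors \<open>exp (- lam n * \<mu>)\<close> are absorbed into the coefficients;
  order and abscissa stay the same.\<close>

lemma has_riesz_germ_translate:
  assumes "has_riesz_germ lam f" "0 \<le> \<mu>"
  shows "has_riesz_germ lam (\<lambda>s. f (of_real \<mu> + s))"
proof -
  obtain a m \<sigma> where m: "0 \<le> m" and \<sigma>: "0 \<le> \<sigma>"
    and conv: "\<And>s. \<sigma> < Re s \<Longrightarrow> ((\<lambda>x. riesz_mean lam a m x s) \<longlongrightarrow> f s) at_top"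
    using assms(1) unfolding has_riesz_germ_def riesz_germ_def half_plane_def by blast
  define b where "b n = a n * exp (- of_real (lam n) * of_real \<mu>)" for n
  have "exp (- of_real (lam n) * (of_real \<mu> + s)) =
      exp (- of_real (lam n) * of_real \<mu>) * exp (- of_real (lam n) * s)" for n and s :: complex
    by (simp only: distrib_left exp_add)
  then have "riesz_mean lam b m x s = riesz_mean lam a m x (of_real \<mu> + s)" for x s
    by (simp add: riesz_mean_def b_def mult.assoc)
  then have "((\<lambda>x. riesz_mean lam b m x s) \<longlongrightarrow> f (of_real \<mu> + s)) at_top" if "\<sigma> < Re s" for s
    using conv[of "of_real \<mu> + s"] that assms(2) by simp
  then show ?thesis
    unfolding has_riesz_germ_def riesz_germ_def half_plane_def using m \<sigma> by blast
qed

section \<open>Comparison of the two growth conditions\<close>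

lemma growth_norm_less_top_iff:
  "growth_norm l f < \<infinity> \<longleftrightarrow>
    (\<exists>B>0. \<forall>s\<in>half_plane 0. cmod (f s) \<le> B * (1 + cmod s) powr l)"
proof
  assume *: "growth_norm l f < \<infinity>"
  have le: "ereal (cmod (f s) / (1 + cmod s) powr l) \<le> growth_norm l f" if "s \<in> half_plane 0" for s
    unfolding growth_norm_def using that by (rule SUP_upper)
  define B where "B = max 1 (real_of_ereal (growth_norm l f))"
  have B: "growth_norm l f \<le> ereal B" "0 < B"
    using * by (cases "growth_norm l f"; simp add: B_def)+
  have "cmod (f s) \<le> B * (1 + cmod s) powr l" if "s \<in> half_plane 0" for s
  proof -
    have "0 < 1 + cmod s"
      by (simp add: add_pos_nonneg)
    then show ?thesis
      using order_trans[OF le[OF that] B(1)] by (simp add: divide_le_eq)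
  qed
  then show "\<exists>B>0. \<forall>s\<in>half_plane 0. cmod (f s) \<le> B * (1 + cmod s) powr l"
    using B by blast
next
  assume "\<exists>B>0. \<forall>s\<in>half_plane 0. cmod (f s) \<le> B * (1 + cmod s) powr l"
  then obtain B where B: "\<And>s. s \<in> half_plane 0 \<Longrightarrow> cmod (f s) \<le> B * (1 + cmod s) powr l"
    by blast
  have "growth_norm l f \<le> ereal B"
    unfolding growth_norm_def
  proof (rule SUP_least)
    fix s assume "s \<in> half_plane 0"
    have "0 < 1 + cmod s"
      by (simp add: add_pos_nonneg)
    then show "ereal (cmod (f s) / (1 + cmod s) powr l) \<le> ereal B"
      using B[OF \<open>s \<in> half_plane 0\<close>] by (simp add: divide_le_eq)
  qed
  then show "growth_norm l f < \<infinity>"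
    by (rule le_less_trans) simp
qed

text \<open>On the far sector a constant is dominated by a multiple of
  \<open>\<bar>t\<bar> powr l\<close>, since \<open>\<bar>t\<bar> > 1\<close> and
  \<open>l \<ge> 0\<close>. Elsewhere \<open>1 + cmod s\<close> is at most a multiple of
  \<open>\<bar>t\<bar>\<close>.\<close>

lemma H_infty_imp_vertical_bound:
  assumes lam: "frequency lam" and "0 \<le> l" and f: "f \<in> H_infty lam l"
  obtains C where "0 < C"
    "\<And>\<sigma> t. 0 < \<sigma> \<Longrightarrow> 1 < \<bar>t\<bar> \<Longrightarrow> cmod (f (Complex \<sigma> t)) \<le> C * \<bar>t\<bar> powr l"
proof -
  obtain B where B: "0 < B" "\<And>s. 0 < Re s \<Longrightarrow> cmod (f s) \<le> B * (1 + cmod s) powr l"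
    using f unfolding H_infty_def growth_norm_less_top_iff half_plane_def by auto
  obtain C r where C: "0 < C" "1 \<le> r"
    "\<And>s. r \<le> Re s \<Longrightarrow> \<bar>Im s\<bar> \<le> Re s \<Longrightarrow> cmod (f s) \<le> C"
    using riesz_germ_bounded_on_sector[OF lam] f unfolding H_infty_def by blast
  show thesis
  proof (rule that[of "C + B * (2 + r) powr l"])
    show "0 < C + B * (2 + r) powr l"
      using B C by (simp add: add_pos_nonneg)
    fix \<sigma> t :: real assume \<sigma>: "0 < \<sigma>" and t: "1 < \<bar>t\<bar>"
    have nonneg: "0 \<le> C * \<bar>t\<bar> powr l" "0 \<le> B * (2 + r) powr l * \<bar>t\<bar> powr l"
      using B C by auto
    have "cmod (f (Complex \<sigma> t)) \<le> C * \<bar>t\<bar> powr l + B * (2 + r) powr l * \<bar>t\<bar> powr l"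
    proof (cases "r \<le> \<sigma> \<and> \<bar>t\<bar> \<le> \<sigma>")
      case True
      then have "cmod (f (Complex \<sigma> t)) \<le> C"
        by (intro C) auto
      also have "\<dots> \<le> C * \<bar>t\<bar> powr l"
        using C t \<open>0 \<le> l\<close> by (simp add: ge_one_powr_ge_zero)
      finally show ?thesis
        using nonneg by linarith
    next
      case False
      \<comment> \<open>Off the far sector \<open>\<sigma>\<close> is below \<open>r\<close> or
        below \<open>\<bar>t\<bar>\<close>, in both cases at most \<open>r * \<bar>t\<bar>\<close>.
        Adding \<open>1 \<le> \<bar>t\<bar>\<close> and \<open>\<bar>t\<bar>\<close> itself gives
        the constant \<open>2 + r\<close>.\<close>
      have "r * 1 \<le> r * \<bar>t\<bar>" "1 * \<bar>t\<bar> \<le> r * \<bar>t\<bar>"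
        using C(2) t by (intro mult_mono; simp)+
      then have "\<sigma> \<le> r * \<bar>t\<bar>"
        using False by linarith
      moreover have "cmod (Complex \<sigma> t) \<le> \<sigma> + \<bar>t\<bar>"
        using cmod_le[of "Complex \<sigma> t"] \<sigma> by simp
      ultimately have "1 + cmod (Complex \<sigma> t) \<le> (2 + r) * \<bar>t\<bar>"
        using t by (simp add: algebra_simps)
      then have "(1 + cmod (Complex \<sigma> t)) powr l \<le> ((2 + r) * \<bar>t\<bar>) powr l"
        using \<open>0 \<le> l\<close> by (intro powr_mono2) auto
      also have "\<dots> = (2 + r) powr l * \<bar>t\<bar> powr l"
        using C(2) by (simp add: powr_mult)
      finally have "B * (1 + cmod (Complex \<sigma> t)) powr l \<le> B * (2 + r) powr l * \<bar>t\<bar> powr l"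
        using B(1) by simp
      moreover have "cmod (f (Complex \<sigma> t)) \<le> B * (1 + cmod (Complex \<sigma> t)) powr l"
        using \<sigma> by (intro B) simp
      ultimately show ?thesis
        using nonneg by linarith
    qed
    then show "cmod (f (Complex \<sigma> t)) \<le> (C + B * (2 + r) powr l) * \<bar>t\<bar> powr l"
      by (simp add: ring_distribs)
  qed
qed

text \<open>The hypothesis covers large imaginary parts and the sector bound covers large real
  parts. On the remaining rectangle continuity suffices, because the shift by \<open>\<mu>\<close>
  keeps it away from the boundary line.\<close>

lemma vertical_bound_imp_translate_in_H_infty:
  assumes lam: "frequency lam" and "0 \<le> l"
    and hol: "f holomorphic_on half_plane 0" and germ: "has_riesz_germ lam f"
    and "0 < C" and \<mu>: "0 < \<mu>"
    and C: "\<And>\<sigma> t. 0 < \<sigma> \<Longrightarrow> t0 < \<bar>t\<bar> \<Longrightarrow> cmod (f (Complex \<sigma> t)) \<le> C * \<bar>t\<bar> powr l"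
  shows "(\<lambda>s. f (of_real \<mu> + s)) \<in> H_infty lam l"
proof -
  obtain C' r where C': "0 < C'" "1 \<le> r"
    "\<And>s. r \<le> Re s \<Longrightarrow> \<bar>Im s\<bar> \<le> Re s \<Longrightarrow> cmod (f s) \<le> C'"
    using riesz_germ_bounded_on_sector[OF lam germ] by blast
  \<comment> \<open>To the right of \<open>max r t0\<close> a point with
    \<open>\<bar>Im s\<bar> \<le> t0\<close> lies in the far sector; the left edge
    \<open>\<mu> > 0\<close> keeps \<open>K\<close> inside the domain of \<open>f\<close>.\<close>
  define K where "K = cbox (Complex \<mu> (- t0)) (Complex (max r t0) t0)"
  have K: "s \<in> K \<longleftrightarrow> \<mu> \<le> Re s \<and> Re s \<le> max r t0 \<and> \<bar>Im s\<bar> \<le> t0" for s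
    by (auto simp: K_def in_cbox_complex_iff)
  have "continuous_on K f"
    using \<mu> by (intro continuous_on_subset[OF holomorphic_on_imp_continuous_on[OF hol]])
      (auto simp: K half_plane_def)
  then have "bounded (f ` K)"
    unfolding K_def by (intro compact_imp_bounded compact_continuous_image) auto
  then obtain C'' where C'': "0 < C''" "\<And>s. s \<in> K \<Longrightarrow> cmod (f s) \<le> C''"
    unfolding bounded_pos by blast
  have "cmod (f (of_real \<mu> + s)) \<le> (C + C' + C'') * (1 + cmod s) powr l" if s: "0 < Re s" for s
  proof -
    define p where "p = (1 + cmod s) powr l"
    have p: "1 \<le> p"
      using \<open>0 \<le> l\<close> by (simp add: p_def ge_one_powr_ge_zero)
    then have scale: "0 \<le> C * p" "C' \<le> C' * p" "C'' \<le> C'' * p"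
      using \<open>0 < C\<close> C'(1) C''(1) by auto
    consider "t0 < \<bar>Im s\<bar>" | "\<bar>Im s\<bar> \<le> t0" "max r t0 < \<mu> + Re s"
      | "\<bar>Im s\<bar> \<le> t0" "\<mu> + Re s \<le> max r t0"
      by linarith
    then have "cmod (f (of_real \<mu> + s)) \<le> C * p + C' * p + C'' * p"
    proof cases
      case 1
      have "of_real \<mu> + s = Complex (\<mu> + Re s) (Im s)"
        by (simp add: complex_eq_iff)
      then have "cmod (f (of_real \<mu> + s)) \<le> C * \<bar>Im s\<bar> powr l"
        using 1 s \<mu> C[of "\<mu> + Re s" "Im s"] by simp
      also have "\<dots> \<le> C * p"
        using \<open>0 < C\<close> \<open>0 \<le> l\<close> abs_Im_le_cmod[of s] unfolding p_def
        by (intro mult_left_mono powr_mono2) auto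
      finally show ?thesis
        using scale C'(1) C''(1) by linarith
    next
      case 2
      then have "cmod (f (of_real \<mu> + s)) \<le> C'"
        by (intro C') auto
      then show ?thesis
        using scale C''(1) by linarith
    next
      case 3
      then have "cmod (f (of_real \<mu> + s)) \<le> C''"
        using s by (intro C'') (simp add: K)
      then show ?thesis
        using scale C'(1) by linarith
    qed
    then show ?thesis
      by (simp add: p_def ring_distribs)
  qed
  moreover have "0 < C + C' + C''"
    using \<open>0 < C\<close> C'(1) C''(1) by simp
  ultimately have "growth_norm l (\<lambda>s. f (of_real \<mu> + s)) < \<infinity>"
    unfolding growth_norm_less_top_iff half_plane_def by blast
  moreover have "(\<lambda>s. f (of_real \<mu> + s)) holomorphic_on half_plane 0"
    using \<mu> by (intro holomorphic_on_compose_gen[OF _ hol, unfolded o_def] holomorphic_intros)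
      (auto simp: half_plane_def)
  ultimately show ?thesis
    using has_riesz_germ_translate[OF germ] \<mu> by (simp add: H_infty_def)
qed

theorem theorem3p21:
  fixes lam :: "nat \<Rightarrow> real" and l :: real and f :: "complex \<Rightarrow> complex"
  assumes "frequency lam"
    and "0 \<le> l"
    and "f holomorphic_on half_plane 0"
    and "has_riesz_germ lam f"
  shows "(f \<in> H_infty lam l \<longrightarrow>
           (\<exists>C>0. \<forall>\<sigma>>0. \<forall>t. \<bar>t\<bar> > 1 \<longrightarrow> cmod (f (Complex \<sigma> t)) \<le> C * \<bar>t\<bar> powr l))
       \<and> (f \<in> H_infty lam l \<longrightarrow> finite_uniform_order f \<and> uniform_order f \<le> ereal l)
       \<and> ((\<exists>C>0. \<exists>t0>0. \<forall>\<sigma>>0. \<forall>t. \<bar>t\<bar> > t0 \<longrightarrow>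
              cmod (f (Complex \<sigma> t)) \<le> C * \<bar>t\<bar> powr l) \<longrightarrow>
           (\<forall>\<mu>>0. (\<lambda>s. f (of_real \<mu> + s)) \<in> H_infty lam l))
       \<and> (finite_uniform_order f \<and> uniform_order f < ereal l \<longrightarrow>
           (\<forall>\<mu>>0. (\<lambda>s. f (of_real \<mu> + s)) \<in> H_infty lam l))"
proof (intro conjI impI)
  assume f: "f \<in> H_infty lam l"
  show "\<exists>C>0. \<forall>\<sigma>>0. \<forall>t. \<bar>t\<bar> > 1 \<longrightarrow> cmod (f (Complex \<sigma> t)) \<le> C * \<bar>t\<bar> powr l"
    using H_infty_imp_vertical_bound[OF assms(1,2) f] by metis
next
  assume f: "f \<in> H_infty lam l"
  obtain C where "0 < C"
    "\<And>\<sigma> t. 0 < \<sigma> \<Longrightarrow> 1 < \<bar>t\<bar> \<Longrightarrow> cmod (f (Complex \<sigma> t)) \<le> C * \<bar>t\<bar> powr l"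
    using H_infty_imp_vertical_bound[OF assms(1,2) f] by blast
  \<comment> \<open>The exponent \<open>l\<close> itself belongs to the set under the infimum, with
    threshold 1.\<close>
  then show order: "uniform_order f \<le> ereal l"
    unfolding uniform_order_def
    using assms(2) zero_less_one by (intro Inf_lower imageI CollectI conjI) blast+
  show "finite_uniform_order f"
    unfolding finite_uniform_order_def by (rule le_less_trans[OF order]) simp
next
  assume "\<exists>C>0. \<exists>t0>0. \<forall>\<sigma>>0. \<forall>t. \<bar>t\<bar> > t0 \<longrightarrow>
    cmod (f (Complex \<sigma> t)) \<le> C * \<bar>t\<bar> powr l"
  then show "\<forall>\<mu>>0. (\<lambda>s. f (of_real \<mu> + s)) \<in> H_infty lam l"
    using vertical_bound_imp_translate_in_H_infty[OF assms] by metis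
next
  assume "finite_uniform_order f \<and> uniform_order f < ereal l"
  then obtain l' where "0 \<le> l'" "l' < l" "\<exists>C>0. \<exists>t0>0. \<forall>\<sigma>>0. \<forall>t. \<bar>t\<bar> > t0 \<longrightarrow>
      cmod (f (Complex \<sigma> t)) \<le> C * \<bar>t\<bar> powr l'"
    unfolding uniform_order_def Inf_less_iff by auto
  then obtain C t0 where l': "0 \<le> l'" "l' < l" "0 < C" and C:
    "\<And>\<sigma> t. 0 < \<sigma> \<Longrightarrow> t0 < \<bar>t\<bar> \<Longrightarrow> cmod (f (Complex \<sigma> t)) \<le> C * \<bar>t\<bar> powr l'"
    by blast
  \<comment> \<open>Raising the threshold to \<open>max 1 t0\<close> ensures
    \<open>\<bar>t\<bar> > 1\<close>, where powers increase with the exponent; so the admissible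
    \<open>l' < l\<close> may be replaced by \<open>l\<close>.\<close>
  have "cmod (f (Complex \<sigma> t)) \<le> C * \<bar>t\<bar> powr l" if "0 < \<sigma>" "max 1 t0 < \<bar>t\<bar>" for \<sigma> t
  proof -
    have "cmod (f (Complex \<sigma> t)) \<le> C * \<bar>t\<bar> powr l'"
      using that by (intro C) auto
    also have "\<dots> \<le> C * \<bar>t\<bar> powr l"
      using l' that by (intro mult_left_mono powr_mono) auto
    finally show ?thesis .
  qed
  then show "\<forall>\<mu>>0. (\<lambda>s. f (of_real \<mu> + s)) \<in> H_infty lam l"
    using vertical_bound_imp_translate_in_H_infty[OF assms l'(3)] by blast
qed

end
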